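(* Let $A$ and $B$ be finite subsets of an abelian group $G$ (written additively) of the same size $k$. For each $a\in A$ and $b\in B$ define $$A_b:=\{a'\in A : a'+b\notin A\},\qquad B_a:=\{b'\in B : a+b'\notin A\}.$$ Then the number of matchings from $A$ to $B$ satisfies the upper bound $$\#\mathcal{M}(A,B)\leq\min\left\{\prod_{a\in A}\big((\#B_a)!\big)^{\frac{1}{\#B_a}},\ \prod_{b\in B}\big((\#A_b)!\big)^{\frac{1}{\#A_b}}\right\},$$ where $(0!)^{1/0}$ is interpreted as $0$. Moreover, if the elements of $A=\{a_1,\dots,a_k\}$ and $B=\{b_1,\dots,b_k\}$ are labelled so that $$\#B_{a_1}\leq\dots\leq\#B_{a_k},\qquad \#A_{b_1}\leq\dots\leq\#A_{b_k},$$ then $$\#\mathcal{M}(A,B)\geq\max\left\{\prod_{i=1}^k\max(\#B_{a_i}-i+1,0),\ \prod_{i=1}^k\max(\#A_{b_i}-i+1,0)\right\}.$$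
   Context: A matching from $A$ to $B$ is a bijection $f:A\to B$ such that $a+f(a)\notin A$ for every $a\in A$. $\mathcal{M}(A,B)$ denotes the set of all matchings from $A$ to $B$; in particular, it is empty if $0\in B$. *)

theory Defs
  imports Complex_Main "HOL-Library.FuncSet"
begin

text \<open>Membership in \<^term>\<open>extensional A\<close> makes each bijection from \<open>A\<close> to \<open>B\<close> be represented by
  exactly one function, so that counting functions counts bijections.\<close>

definition matchings :: "'a::ab_group_add set \<Rightarrow> 'a set \<Rightarrow> ('a \<Rightarrow> 'a) set" where
  "matchings A B = {f \<in> extensional A. bij_betw f A B \<and> (\<forall>a\<in>A. a + f a \<notin> A)}"

definition A_sub :: "'a::ab_group_add set \<Rightarrow> 'a \<Rightarrow> 'a set" where
  "A_sub A b = {a' \<in> A. a' + b \<notin> A}"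

definition B_sub :: "'a::ab_group_add set \<Rightarrow> 'a set \<Rightarrow> 'a \<Rightarrow> 'a set" where
  "B_sub A B a = {b' \<in> B. a + b' \<notin> A}"

text \<open>The number \<open>(n!)\<close> to the power \<open>1/n\<close>. The case distinction is needed because
  \<^term>\<open>fact 0 powr (1 / 0) = (1::real)\<close> in HOL, whereas the convention here is \<open>0\<close>.\<close>

definition fact_root :: "nat \<Rightarrow> real" where
  "fact_root n = (if n = 0 then 0 else fact n powr (1 / real n))"

end

theory Submission
  imports Defs
begin

text \<open>
  A matching from \<open>A\<close> to \<open>B\<close> is a perfect matching of the bipartite graph in which \<open>a\<close> and \<open>b\<close>
  are adjacent iff \<open>a + b \<notin> A\<close>; the sets \<open>B\<^sub>a\<close> and \<open>A\<^sub>b\<close> are the neighbourhoods of its vertices.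
  Both bounds are therefore instances of bounds for an arbitrary bipartite relation, that is, for
  the permanent of a 0-1 matrix. Each is proved for the rows of the matrix
  (\<open>bregman_minc\<close> and \<open>card_saturating_matchings_ge_prod\<close>), and the
  column version follows because inverting a bijection transposes the relation
  (\<open>card_saturating_matchings_converse\<close>).

  The lower bound is greedy: when the vertices are matched in the order \<open>a\<^sub>1, a\<^sub>2, \<dots>\<close>, at most
  \<open>i - 1\<close> of the neighbours of \<open>a\<^sub>i\<close> are already taken.

  The upper bound is Bregman's theorem (Minc's conjecture), proved here by Schrijver's induction,
  written additively with logarithms. Let \<open>P\<close> be the number of perfect matchings, \<open>r\<^sub>i\<close> the degree
  of row \<open>i\<close>, and \<open>t\<^sub>i\<^sub>k\<close> the number of perfect matchings that use the edge \<open>(i, k)\<close>. For each row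
  \<open>i\<close> the numbers \<open>t\<^sub>i\<^sub>k\<close> add up to \<open>P\<close>, and convexity of \<open>x ln x\<close> gives
  \<open>P ln P \<le> P ln r\<^sub>i + (\<Sum>k. t\<^sub>i\<^sub>k ln t\<^sub>i\<^sub>k)\<close>. Here the last sum equals the sum of \<open>ln t\<^sub>i\<^sub>k\<close> with
  \<open>k = \<nu> i\<close> over all perfect matchings \<open>\<nu>\<close>. The induction hypothesis bounds each \<open>t\<^sub>i\<^sub>k\<close>, a count
  of perfect matchings of the graph without \<open>i\<close> and \<open>k\<close>, in terms of the degrees there. After
  summation over \<open>i\<close>, the contributions for a fixed \<open>\<nu>\<close> can be counted exactly: deleting \<open>i\<close> and
  \<open>\<nu> i\<close> lowers the degree of row \<open>j\<close> for \<open>r\<^sub>j - 1\<close> choices of \<open>i \<noteq> j\<close> and leaves it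
  unchanged for the other \<open>n - r\<^sub>j\<close>, and everything collapses to \<open>n\<close> times the logarithm of the
  claimed bound.
\<close>

section \<open>Matchings along a bipartite relation\<close>

text \<open>Only \<open>A\<close> has to be covered, so that the greedy argument can run through the partial matchings
  of initial segments of \<open>A\<close>. When \<open>A\<close> and \<open>B\<close> are finite of equal size, these are the perfect
  matchings.\<close>

definition saturating_matchings :: "'a set \<Rightarrow> 'b set \<Rightarrow> ('a \<Rightarrow> 'b \<Rightarrow> bool) \<Rightarrow> ('a \<Rightarrow> 'b) set" where
  "saturating_matchings A B R = {f \<in> A \<rightarrow>\<^sub>E B. inj_on f A \<and> (\<forall>a\<in>A. R a (f a))}"

definition degree :: "'b set \<Rightarrow> ('a \<Rightarrow> 'b \<Rightarrow> bool) \<Rightarrow> 'a \<Rightarrow> nat" where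
  "degree B R a = card {b \<in> B. R a b}"

lemma finite_saturating_matchings:
  assumes "finite A" "finite B"
  shows "finite (saturating_matchings A B R)"
  unfolding saturating_matchings_def
  by (rule finite_subset[OF _ finite_PiE[of A "\<lambda>_. B"]]) (use assms in auto)

lemma saturating_matching_bij_betw:
  assumes "finite B" "card A = card B" "f \<in> saturating_matchings A B R"
  shows "bij_betw f A B"
proof -
  have "inj_on f A" "f ` A \<subseteq> B"
    using assms by (auto simp: saturating_matchings_def)
  then have "f ` A = B"
    using assms by (intro card_subset_eq) (auto simp: card_image)
  then show ?thesis
    using \<open>inj_on f A\<close> by (simp add: bij_betw_def)
qed

lemma saturating_matching_fun_upd:
  assumes "f \<in> saturating_matchings A B R" "x \<notin> A" "b \<in> B" "R x b" "b \<notin> f ` A"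
  shows "f(x := b) \<in> saturating_matchings (insert x A) B R"
proof -
  have "inj_on (f(x := b)) (insert x A)"
    using assms by (auto simp: saturating_matchings_def inj_on_fun_updI)
  moreover have "f(x := b) \<in> insert x A \<rightarrow>\<^sub>E B"
    using assms by (intro PiE_fun_upd) (auto simp: saturating_matchings_def)
  moreover have "\<forall>y\<in>insert x A. R y ((f(x := b)) y)"
    using assms by (auto simp: saturating_matchings_def)
  ultimately show ?thesis
    by (simp only: saturating_matchings_def mem_Collect_eq)
qed

lemma matchings_eq_saturating_matchings:
  assumes "finite B" "card A = card B"
  shows "matchings A B = saturating_matchings A B (\<lambda>a b. a + b \<notin> A)"
proof
  show "matchings A B \<subseteq> saturating_matchings A B (\<lambda>a b. a + b \<notin> A)"
    by (auto simp: matchings_def saturating_matchings_def bij_betw_def PiE_def)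
  show "saturating_matchings A B (\<lambda>a b. a + b \<notin> A) \<subseteq> matchings A B"
    using saturating_matching_bij_betw[OF assms]
    by (fastforce simp: matchings_def saturating_matchings_def PiE_def)
qed

lemma card_saturating_matchings_le_converse:
  assumes "finite A" "finite B" "card A = card B"
  shows "card (saturating_matchings A B R) \<le> card (saturating_matchings B A (\<lambda>b a. R a b))"
proof (rule card_inj_on_le)
  let ?T = "\<lambda>f. restrict (inv_into A f) B"
  show "inj_on ?T (saturating_matchings A B R)"
  proof (rule inj_onI)
    fix f g assume f: "f \<in> saturating_matchings A B R" and g: "g \<in> saturating_matchings A B R"
      and eq: "?T f = ?T g"
    have bf: "bij_betw f A B" and bg: "bij_betw g A B"
      using f g saturating_matching_bij_betw assms by blast+
    show "f = g"
    proof (rule PiE_ext)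
      show "f \<in> A \<rightarrow>\<^sub>E B" "g \<in> A \<rightarrow>\<^sub>E B"
        using f g by (auto simp: saturating_matchings_def)
      fix a assume a: "a \<in> A"
      then have fa: "f a \<in> B"
        using bf by (auto simp: bij_betw_def)
      have "a = inv_into A f (f a)"
        using bf a by (simp add: bij_betw_def)
      also have "\<dots> = inv_into A g (f a)"
        using fun_cong[OF eq, of "f a"] fa by simp
      finally show "f a = g a"
        using bg fa by (metis bij_betw_inv_into_right)
    qed
  qed
  show "?T ` saturating_matchings A B R \<subseteq> saturating_matchings B A (\<lambda>b a. R a b)"
  proof
    fix g assume "g \<in> ?T ` saturating_matchings A B R"
    then obtain f where f: "f \<in> saturating_matchings A B R" and g: "g = ?T f"
      by auto
    have bf: "bij_betw f A B"
      using f saturating_matching_bij_betw assms by blast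
    have bi: "bij_betw (inv_into A f) B A"
      using bf by (rule bij_betw_inv_into)
    have "R (inv_into A f b) b" if "b \<in> B" for b
    proof -
      have "inv_into A f b \<in> A" "f (inv_into A f b) = b"
        using bi bf that by (auto simp: bij_betw_def f_inv_into_f)
      then show ?thesis
        using f by (force simp: saturating_matchings_def)
    qed
    then show "g \<in> saturating_matchings B A (\<lambda>b a. R a b)"
      using bi unfolding g by (auto simp: saturating_matchings_def bij_betw_def inj_on_def)
  qed
  show "finite (saturating_matchings B A (\<lambda>b a. R a b))"
    using assms by (intro finite_saturating_matchings)
qed

lemma card_saturating_matchings_converse:
  assumes "finite A" "finite B" "card A = card B"
  shows "card (saturating_matchings A B R) = card (saturating_matchings B A (\<lambda>b a. R a b))"
  using card_saturating_matchings_le_converse[OF assms, of R]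
    card_saturating_matchings_le_converse[of B A "\<lambda>b a. R a b"] assms
  by simp

section \<open>The greedy lower bound\<close>

text \<open>A matching of \<open>A\<close> can be continued at a new vertex \<open>x\<close> by any neighbour of \<open>x\<close> outside its
  range, which has \<open>card A\<close> elements.\<close>

lemma card_saturating_matchings_insert_ge:
  assumes "finite A" "finite B" "x \<notin> A"
  shows "card (saturating_matchings A B R) * (degree B R x - card A)
    \<le> card (saturating_matchings (insert x A) B R)"
proof -
  let ?M = "saturating_matchings A B R"
  let ?N = "\<lambda>f. {b \<in> B. R x b} - f ` A"
  have fin: "finite ?M"
    using assms by (intro finite_saturating_matchings)
  have "card ?M * (degree B R x - card A) = (\<Sum>f\<in>?M. degree B R x - card A)"
    by simp
  also have "\<dots> \<le> (\<Sum>f\<in>?M. card (?N f))"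
  proof (rule sum_mono)
    fix f assume "f \<in> ?M"
    have "degree B R x - card A \<le> degree B R x - card (f ` A)"
      using card_image_le[OF assms(1), of f] by linarith
    also have "\<dots> \<le> card (?N f)"
      unfolding degree_def using assms by (intro diff_card_le_card_Diff) auto
    finally show "degree B R x - card A \<le> card (?N f)" .
  qed
  also have "\<dots> = card (Sigma ?M ?N)"
    using fin assms by simp
  also have "\<dots> \<le> card (saturating_matchings (insert x A) B R)"
  proof (rule card_inj_on_le)
    show "inj_on (\<lambda>(f, b). f(x := b)) (Sigma ?M ?N)"
    proof (rule inj_onI, clarify)
      fix f b g c
      assume f: "f \<in> ?M" and g: "g \<in> ?M" and eq: "f(x := b) = g(x := c)"
      have "f y = g y" for y
        using fun_cong[OF eq, of y] f g assms
        by (cases "y = x") (auto simp: saturating_matchings_def PiE_def extensional_def)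
      then show "f = g \<and> b = c"
        using fun_cong[OF eq, of x] by auto
    qed
    show "(\<lambda>(f, b). f(x := b)) ` Sigma ?M ?N \<subseteq> saturating_matchings (insert x A) B R"
      using assms(3) by (auto intro: saturating_matching_fun_upd)
    show "finite (saturating_matchings (insert x A) B R)"
      using assms by (intro finite_saturating_matchings) auto
  qed
  finally show ?thesis .
qed

lemma card_saturating_matchings_ge_prod:
  assumes "finite B" "inj_on a {1..k}"
  shows "(\<Prod>i=1..k. degree B R (a i) - (i - 1)) \<le> card (saturating_matchings (a ` {1..k}) B R)"
  using assms(2)
proof (induction k)
  case 0
  show ?case
    by (simp add: saturating_matchings_def)
next
  case (Suc k)
  have inj: "inj_on a {1..k}"
    using Suc.prems by (rule inj_on_subset) auto
  have new: "a (Suc k) \<notin> a ` {1..k}"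
    using Suc.prems by (force simp: inj_on_def)
  have "(\<Prod>i=1..Suc k. degree B R (a i) - (i - 1))
      = (\<Prod>i=1..k. degree B R (a i) - (i - 1)) * (degree B R (a (Suc k)) - card (a ` {1..k}))"
    using inj by (simp add: card_image)
  also have "\<dots> \<le> card (saturating_matchings (a ` {1..k}) B R)
      * (degree B R (a (Suc k)) - card (a ` {1..k}))"
    using Suc.IH[OF inj] by (rule mult_right_mono) simp
  also have "\<dots> \<le> card (saturating_matchings (insert (a (Suc k)) (a ` {1..k})) B R)"
    using new assms(1) by (intro card_saturating_matchings_insert_ge) auto
  also have "insert (a (Suc k)) (a ` {1..k}) = a ` {1..Suc k}"
    by (simp add: atLeastAtMostSuc_conv)
  finally show ?case .
qed

lemma greedy_lower_bound:
  assumes "finite B" "bij_betw a {1..k} A"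
  shows "(\<Prod>i=1..k. max (int (degree B R (a i)) - int i + 1) 0)
    \<le> int (card (saturating_matchings A B R))"
proof -
  have "(\<Prod>i=1..k. max (int (degree B R (a i)) - int i + 1) 0)
      = int (\<Prod>i=1..k. degree B R (a i) - (i - 1))"
    unfolding of_nat_prod by (rule prod.cong) auto
  also have "\<dots> \<le> int (card (saturating_matchings (a ` {1..k}) B R))"
    using assms by (intro iffD2[OF of_nat_le_iff] card_saturating_matchings_ge_prod)
      (auto simp: bij_betw_def)
  also have "a ` {1..k} = A"
    using assms by (simp add: bij_betw_def)
  finally show ?thesis .
qed

section \<open>Bregman's upper bound\<close>

text \<open>Deleting a matched pair \<open>i\<close>, \<open>k\<close> turns the matchings through the edge \<open>(i, k)\<close> into the
  matchings of a smaller relation, which is what makes induction possible.\<close>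

lemma card_saturating_matchings_through_edge:
  assumes "finite A" "finite B" "i \<in> A" "k \<in> B" "R i k"
  shows "card {f \<in> saturating_matchings A B R. f i = k}
    = card (saturating_matchings (A - {i}) (B - {k}) R)"
proof (rule bij_betw_same_card)
  let ?E = "{f \<in> saturating_matchings A B R. f i = k}"
  let ?D = "saturating_matchings (A - {i}) (B - {k}) R"
  have del: "restrict f (A - {i}) \<in> ?D" if "f \<in> ?E" for f
    using that assms by (auto simp: saturating_matchings_def inj_on_def)
  have add: "g(i := k) \<in> ?E" if "g \<in> ?D" for g
  proof -
    have "g \<in> saturating_matchings (A - {i}) B R" "k \<notin> g ` (A - {i})"
      using that by (auto simp: saturating_matchings_def)
    then have "g(i := k) \<in> saturating_matchings (insert i (A - {i})) B R"
      using assms by (intro saturating_matching_fun_upd) auto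
    then show ?thesis
      using assms by (simp add: insert_absorb)
  qed
  show "bij_betw (\<lambda>f. restrict f (A - {i})) ?E ?D"
  proof (rule bij_betw_byWitness[where f' = "\<lambda>g. g(i := k)"])
    show "\<forall>f\<in>?E. (restrict f (A - {i}))(i := k) = f"
      by (auto simp: saturating_matchings_def PiE_def extensional_def fun_eq_iff)
    show "\<forall>g\<in>?D. restrict (g(i := k)) (A - {i}) = g"
      by (auto simp: saturating_matchings_def PiE_def extensional_def fun_eq_iff)
  qed (use del add in blast)+
qed

text \<open>Convexity of \<open>x ln x\<close> (equivalently, entropy is maximal for the uniform distribution). It
  follows from \<open>ln y \<le> y - 1\<close> at the quotient of the average \<open>T / r\<close> by each \<open>t k\<close>.\<close>

lemma sum_mult_ln_sum_le:
  fixes t :: "'a \<Rightarrow> real"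
  assumes "finite S" "\<And>k. k \<in> S \<Longrightarrow> 0 \<le> t k" "0 < sum t S"
  shows "sum t S * ln (sum t S) \<le> sum t S * ln (card S) + (\<Sum>k\<in>S. t k * ln (t k))"
proof -
  define T r where "T = sum t S" and "r = real (card S)"
  have T: "T > 0"
    using assms by (simp add: T_def)
  have "S \<noteq> {}"
    using assms(3) by auto
  then have r: "r > 0"
    using assms(1) by (simp add: r_def card_gt_0_iff)
  have pointwise: "t k * (ln T - ln r) - t k * ln (t k) \<le> T / r - t k" if "k \<in> S" for k
  proof (cases "t k = 0")
    case True
    then show ?thesis using T r by simp
  next
    case False
    then have tk: "t k > 0"
      using assms(2)[OF that] by simp
    have "t k * (ln T - ln r) - t k * ln (t k) = t k * ln (T / r / t k)"
      using tk T r by (simp add: ln_div ln_mult algebra_simps)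
    also have "\<dots> \<le> t k * (T / r / t k - 1)"
      using tk T r by (intro mult_left_mono ln_le_minus_one) auto
    also have "\<dots> = T / r - t k"
      using tk by (simp add: algebra_simps)
    finally show ?thesis .
  qed
  have "T * (ln T - ln r) - (\<Sum>k\<in>S. t k * ln (t k))
      = (\<Sum>k\<in>S. t k * (ln T - ln r) - t k * ln (t k))"
    by (simp add: T_def sum_distrib_right sum_subtractf)
  also have "\<dots> \<le> (\<Sum>k\<in>S. T / r - t k)"
    using pointwise by (rule sum_mono)
  also have "\<dots> = 0"
    using r by (simp add: sum_subtractf T_def r_def)
  finally show ?thesis
    unfolding T_def r_def by (simp add: algebra_simps)
qed

lemma fact_root_nonneg: "0 \<le> fact_root m"
  by (simp add: fact_root_def)

lemma fact_root_pos_iff: "0 < fact_root m \<longleftrightarrow> 0 < m"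
  by (simp add: fact_root_def)

text \<open>This includes \<open>m = 0\<close>, where both sides vanish; in the induction below, a row of degree 1 gives
  rise to that case.\<close>

lemma mult_ln_fact_root: "real m * ln (fact_root m) = ln (fact m)"
  by (simp add: fact_root_def ln_powr)

text \<open>The exact count at the heart of the induction, for one row \<open>j\<close> and one perfect matching \<open>\<nu>\<close>.
  As \<open>i\<close> runs through the other rows, \<open>\<nu> i\<close> runs through all columns except \<open>\<nu> j\<close>; of these,
  \<open>r - 1\<close> are neighbours of \<open>j\<close> and \<open>n - r\<close> are not. The sum is therefore
  \<open>(r - 1) L (r - 1) + (n - r) L r\<close> with \<open>L m = ln (m!) / m\<close>, and adding \<open>ln r\<close> completes
  \<open>ln ((r - 1)!)\<close> to \<open>ln (r!)\<close>.\<close>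

lemma ln_degree_plus_sum_deleted_degrees:
  assumes "finite A" "finite B" "bij_betw \<nu> A B" "j \<in> A" "R j (\<nu> j)"
  shows "ln (degree B R j) + (\<Sum>i\<in>A - {j}. ln (fact_root (degree (B - {\<nu> i}) R j)))
    = card A * ln (fact_root (degree B R j))"
proof -
  define N r where "N = {b \<in> B. R j b}" and "r = degree B R j"
  have N: "finite N" "\<nu> j \<in> N" "N \<subseteq> B" "card N = r"
    using assms by (auto simp: N_def r_def degree_def bij_betw_def)
  have r: "r > 0"
    using N card_gt_0_iff by blast
  have le: "r \<le> card A"
    using N assms card_mono bij_betw_same_card by metis
  have card_B: "card B = card A"
    using assms bij_betw_same_card by metis
  have bij: "bij_betw \<nu> (A - {j}) (B - {\<nu> j})"
    using assms by (auto simp: bij_betw_def inj_on_def)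
  have deg: "degree (B - {b}) R j = card (N - {b})" for b
    unfolding degree_def N_def by (rule arg_cong[where f = card]) auto
  have "(\<Sum>i\<in>A - {j}. ln (fact_root (degree (B - {\<nu> i}) R j)))
      = (\<Sum>b\<in>B - {\<nu> j}. ln (fact_root (card (N - {b}))))"
    unfolding deg using bij by (rule sum.reindex_bij_betw)
  also have "\<dots> = (\<Sum>b\<in>N - {\<nu> j}. ln (fact_root (card (N - {b}))))
      + (\<Sum>b\<in>B - N. ln (fact_root (card (N - {b}))))"
  proof -
    have "B - {\<nu> j} = (N - {\<nu> j}) \<union> (B - N)"
      using N by auto
    then show ?thesis
      using N assms(2) by (simp only:) (intro sum.union_disjoint; auto)
  qed
  also have "(\<Sum>b\<in>N - {\<nu> j}. ln (fact_root (card (N - {b}))))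
      = (\<Sum>b\<in>N - {\<nu> j}. ln (fact_root (r - 1)))"
    using N by (intro sum.cong) auto
  also have "\<dots> = ln (fact (r - 1))"
    using N mult_ln_fact_root[of "r - 1"] by simp
  also have "(\<Sum>b\<in>B - N. ln (fact_root (card (N - {b}))))
      = (\<Sum>b\<in>B - N. ln (fact_root r))"
    using N by (intro sum.cong) auto
  also have "\<dots> = (real (card A) - real r) * ln (fact_root r)"
    using N le card_B by (simp add: card_Diff_subset of_nat_diff)
  finally have "ln r + (\<Sum>i\<in>A - {j}. ln (fact_root (degree (B - {\<nu> i}) R j)))
      = (ln r + ln (fact (r - 1))) + (real (card A) - real r) * ln (fact_root r)"
    by simp
  also have "ln r + ln (fact (r - 1)) = real r * ln (fact_root r)"
    using r by (simp add: mult_ln_fact_root fact_reduce[of r] ln_mult)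
  finally show ?thesis
    by (simp add: r_def algebra_simps)
qed

theorem bregman_minc:
  assumes "finite A" "finite B" "card A = card B"
  shows "real (card (saturating_matchings A B R)) \<le> (\<Prod>a\<in>A. fact_root (degree B R a))"
  using assms
proof (induction "card A" arbitrary: A B)
  case 0
  then show ?case
    by (simp add: saturating_matchings_def)
next
  case (Suc n)
  define M where "M = saturating_matchings A B R"
  define P where "P = real (card M)"
  define t where "t i k = real (card {f \<in> M. f i = k})" for i k
  define L where "L m = ln (fact_root m)" for m
  have finM: "finite M"
    unfolding M_def using Suc.prems by (intro finite_saturating_matchings)
  show ?case
  proof (cases "M = {}")
    case True
    then show ?thesis
      by (simp add: M_def prod_nonneg fact_root_nonneg)
  next
    case False
    then have P: "P > 0"
      using finM by (simp add: P_def card_gt_0_iff)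
    have bij: "bij_betw \<nu> A B" if "\<nu> \<in> M" for \<nu>
      using that saturating_matching_bij_betw Suc.prems unfolding M_def by blast
    have edge: "\<nu> i \<in> B \<and> R i (\<nu> i)" if "\<nu> \<in> M" "i \<in> A" for \<nu> i
      using that by (auto simp: M_def saturating_matchings_def)
    have deg_pos: "degree B R i > 0" if i: "i \<in> A" for i
    proof -
      obtain \<nu> where "\<nu> \<in> M"
        using False by auto
      then show ?thesis
        using edge[of \<nu> i] i Suc.prems by (auto simp: degree_def card_gt_0_iff)
    qed
    have row: "P * ln P \<le> (\<Sum>\<nu>\<in>M. ln (degree B R i) + ln (t i (\<nu> i)))" if i: "i \<in> A" for i
    proof -
      let ?N = "{k \<in> B. R i k}"
      have fib: "(\<Sum>k\<in>?N. \<Sum>\<nu>\<in>{\<nu> \<in> M. \<nu> i = k}. h \<nu>) = sum h M" for h :: "_ \<Rightarrow> real"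
        using finM Suc.prems edge i by (intro sum.group) auto
      have total: "sum (t i) ?N = P"
        using fib[of "\<lambda>_. 1"] by (simp add: t_def P_def)
      have "P * ln P \<le> P * ln (card ?N) + (\<Sum>k\<in>?N. t i k * ln (t i k))"
        using sum_mult_ln_sum_le[of ?N "t i"] Suc.prems P unfolding total
        by (simp add: t_def)
      also have "(\<Sum>k\<in>?N. t i k * ln (t i k)) = (\<Sum>k\<in>?N. \<Sum>\<nu>\<in>{\<nu> \<in> M. \<nu> i = k}. ln (t i (\<nu> i)))"
        by (rule sum.cong) (auto simp: t_def)
      also have "\<dots> = (\<Sum>\<nu>\<in>M. ln (t i (\<nu> i)))"
        by (rule fib)
      finally show ?thesis
        by (simp add: sum.distrib P_def degree_def)
    qed
    have minor: "ln (t i (\<nu> i)) \<le> (\<Sum>j\<in>A - {i}. L (degree (B - {\<nu> i}) R j))"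
      if \<nu>: "\<nu> \<in> M" and i: "i \<in> A" for \<nu> i
    proof -
      let ?p = "\<lambda>j. fact_root (degree (B - {\<nu> i}) R j)"
      have "{f \<in> M. f i = \<nu> i} \<noteq> {}"
        using \<nu> by auto
      then have t_pos: "t i (\<nu> i) > 0"
        using finM by (simp add: t_def card_gt_0_iff)
      have "t i (\<nu> i) = card (saturating_matchings (A - {i}) (B - {\<nu> i}) R)"
        using card_saturating_matchings_through_edge[of A B i "\<nu> i" R] Suc.prems i edge[OF \<nu> i]
        by (simp add: t_def M_def)
      also have "\<dots> \<le> (\<Prod>j\<in>A - {i}. ?p j)"
        using Suc.hyps(2) Suc.prems i edge[OF \<nu> i] by (intro Suc.hyps(1)) auto
      finally have le: "t i (\<nu> i) \<le> (\<Prod>j\<in>A - {i}. ?p j)" .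
      \<comment> \<open>The edge \<open>(j, \<nu> j)\<close> survives the deletion, so no factor is zero and the logarithm of the
        product is the sum of the logarithms.\<close>
      have pos: "?p j > 0" if j: "j \<in> A - {i}" for j
      proof -
        have "\<nu> j \<in> {b \<in> B - {\<nu> i}. R j b}"
          using edge[OF \<nu>] bij[OF \<nu>] i j by (auto simp: bij_betw_def inj_on_def)
        then show ?thesis
          using Suc.prems by (auto simp: fact_root_pos_iff degree_def card_gt_0_iff)
      qed
      have "ln (t i (\<nu> i)) \<le> ln (\<Prod>j\<in>A - {i}. ?p j)"
        using t_pos le by simp
      also have "\<dots> = (\<Sum>j\<in>A - {i}. L (degree (B - {\<nu> i}) R j))"
        unfolding L_def using pos by (intro ln_prod) (use Suc.prems in \<open>auto simp: less_le\<close>)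
      finally show ?thesis .
    qed
    have per_matching: "(\<Sum>i\<in>A. ln (degree B R i) + ln (t i (\<nu> i)))
        \<le> card A * (\<Sum>j\<in>A. L (degree B R j))" if \<nu>: "\<nu> \<in> M" for \<nu>
    proof -
      have "(\<Sum>i\<in>A. ln (degree B R i) + ln (t i (\<nu> i)))
          \<le> (\<Sum>i\<in>A. ln (degree B R i) + (\<Sum>j\<in>A - {i}. L (degree (B - {\<nu> i}) R j)))"
        using minor[OF \<nu>] by (intro sum_mono add_left_mono) auto
      also have "\<dots> = (\<Sum>j\<in>A. ln (degree B R j))
          + (\<Sum>i\<in>A. \<Sum>j | j \<in> A \<and> i \<noteq> j. L (degree (B - {\<nu> i}) R j))"
        by (simp add: sum.distrib set_diff_eq eq_commute)
      also have "\<dots> = (\<Sum>j\<in>A. ln (degree B R j))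
          + (\<Sum>j\<in>A. \<Sum>i | i \<in> A \<and> i \<noteq> j. L (degree (B - {\<nu> i}) R j))"
        using Suc.prems by (subst sum.swap_restrict) auto
      also have "\<dots> = (\<Sum>j\<in>A. ln (degree B R j) + (\<Sum>i\<in>A - {j}. L (degree (B - {\<nu> i}) R j)))"
        by (simp add: sum.distrib set_diff_eq)
      also have "\<dots> = (\<Sum>j\<in>A. card A * L (degree B R j))"
        unfolding L_def using Suc.prems bij[OF \<nu>] edge[OF \<nu>]
        by (intro sum.cong refl ln_degree_plus_sum_deleted_degrees) auto
      finally show ?thesis
        by (simp add: sum_distrib_left)
    qed
    have "card A * (P * ln P) = (\<Sum>i\<in>A. P * ln P)"
      by simp
    also have "\<dots> \<le> (\<Sum>i\<in>A. \<Sum>\<nu>\<in>M. ln (degree B R i) + ln (t i (\<nu> i)))"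
      using row by (rule sum_mono)
    also have "\<dots> = (\<Sum>\<nu>\<in>M. \<Sum>i\<in>A. ln (degree B R i) + ln (t i (\<nu> i)))"
      by (rule sum.swap)
    also have "\<dots> \<le> (\<Sum>\<nu>\<in>M. card A * (\<Sum>j\<in>A. L (degree B R j)))"
      using per_matching by (rule sum_mono)
    also have "\<dots> = card A * (P * (\<Sum>j\<in>A. L (degree B R j)))"
      by (simp add: P_def)
    finally have "ln P \<le> (\<Sum>j\<in>A. L (degree B R j))"
      using P Suc.hyps(2) by (simp add: mult_le_cancel_left)
    also have "\<dots> = ln (\<Prod>j\<in>A. fact_root (degree B R j))"
      unfolding L_def using Suc.prems deg_pos
      by (intro ln_prod[symmetric]) (auto simp: fact_root_def)
    finally have "P \<le> (\<Prod>j\<in>A. fact_root (degree B R j))"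
      using P deg_pos by (subst (asm) ln_le_cancel_iff) (auto intro!: prod_pos simp: fact_root_pos_iff)
    then show ?thesis
      by (simp add: P_def M_def)
  qed
qed

section \<open>Matchings in abelian groups\<close>

theorem proposition2p14:
  fixes A B :: "'a::ab_group_add set" and k :: nat
  assumes "finite A" and "finite B" and "card A = k" and "card B = k"
  shows "real (card (matchings A B))
           \<le> min (\<Prod>a\<in>A. fact_root (card (B_sub A B a)))
                 (\<Prod>b\<in>B. fact_root (card (A_sub A b)))
       \<and> (\<forall>a b :: nat \<Rightarrow> 'a.
            bij_betw a {1..k} A \<longrightarrow> bij_betw b {1..k} B \<longrightarrow>
            mono_on {1..k} (\<lambda>i. card (B_sub A B (a i))) \<longrightarrow>
            mono_on {1..k} (\<lambda>i. card (A_sub A (b i))) \<longrightarrow>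
            int (card (matchings A B))
              \<ge> max (\<Prod>i=1..k. max (int (card (B_sub A B (a i))) - int i + 1) 0)
                    (\<Prod>i=1..k. max (int (card (A_sub A (b i))) - int i + 1) 0))"
proof -
  let ?R = "\<lambda>a b. a + b \<notin> A"
  let ?R' = "\<lambda>b a. a + b \<notin> A"
  have rows: "card (matchings A B) = card (saturating_matchings A B ?R)"
    using assms by (simp add: matchings_eq_saturating_matchings)
  have cols: "card (matchings A B) = card (saturating_matchings B A ?R')"
    using assms rows card_saturating_matchings_converse[of A B ?R] by simp
  have deg: "card (B_sub A B x) = degree B ?R x" "card (A_sub A y) = degree A ?R' y" for x y
    by (simp_all add: B_sub_def A_sub_def degree_def)
  have "real (card (matchings A B)) \<le> (\<Prod>a\<in>A. fact_root (degree B ?R a))"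
    unfolding rows using assms by (intro bregman_minc) auto
  moreover have "real (card (matchings A B)) \<le> (\<Prod>b\<in>B. fact_root (degree A ?R' b))"
    unfolding cols using assms by (intro bregman_minc) auto
  moreover have "(\<Prod>i=1..k. max (int (degree B ?R (a i)) - int i + 1) 0) \<le> int (card (matchings A B))"
    if "bij_betw a {1..k} A" for a
    unfolding rows using assms that by (intro greedy_lower_bound)
  moreover have "(\<Prod>i=1..k. max (int (degree A ?R' (b i)) - int i + 1) 0) \<le> int (card (matchings A B))"
    if "bij_betw b {1..k} B" for b
    unfolding cols using assms that by (intro greedy_lower_bound)
  ultimately show ?thesis
    unfolding deg by simp
qed

end
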